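(* If $X$ is a Urysohn space, then $$|X|\leq 2^{swL_c(X,2^{\chi(X)})\,\chi(X)}.$$
   Context: A space is Urysohn if any two distinct points have neighborhoods with disjoint closures. $\chi(X)$ is the (infinite) character of $X$. For $A\subseteq X$ and an infinite cardinal $\lambda$, $swL(A,X,\lambda)$ is the least infinite cardinal $\kappa$ such that for every cover $\mathcal{U}$ of $A$ by open sets of $X$ there exists $\mathcal{V}\subseteq\mathcal{U}$ with $|\mathcal{V}|\leq\kappa$ and $|A\setminus\mathrm{cl}(\bigcup\mathcal{V})|<\lambda$. The skew-$\lambda$ weak Lindelöf degree with respect to closed sets is $swL_c(X,\lambda)=\sup\{swL(A,X,\lambda):A\text{ is a closed subset of }X\}$. *)

theory Defs
  imports "HOL-Analysis.Analysis"
begin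

unbundle cardinal_syntax

text \<open>Cardinals are the \<^term>\<open>Card_order\<close> relations of the library, each of which stands for its
  class modulo \<^term>\<open>ordIso\<close>.  The choice below is unique modulo \<^term>\<open>ordIso\<close>.  Minimality is
  tested inside a fixed type only, which loses nothing: every cardinal below a cardinal on a type
  is represented on that type.\<close>

definition least_infinite_card :: "('b rel \<Rightarrow> bool) \<Rightarrow> 'b rel" where
  "least_infinite_card P =
     (SOME \<kappa>. Cinfinite \<kappa> \<and> P \<kappa> \<and> (\<forall>\<mu>. Cinfinite \<mu> \<and> P \<mu> \<longrightarrow> \<kappa> \<le>o \<mu>))"

lemma least_infinite_card:
  fixes P :: "'b rel \<Rightarrow> bool"
  assumes "Cinfinite \<kappa>" "P \<kappa>"
  shows "Cinfinite (least_infinite_card P)" "P (least_infinite_card P)"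
    and "\<And>\<mu>. Cinfinite \<mu> \<Longrightarrow> P \<mu> \<Longrightarrow> least_infinite_card P \<le>o \<mu>"
proof -
  have "\<exists>r\<in>{r. Cinfinite r \<and> P r}. \<forall>r'\<in>{r. Cinfinite r \<and> P r}. r \<le>o r'"
    using assms by (intro exists_minim_Card_order) auto
  then have "\<exists>\<kappa>. Cinfinite \<kappa> \<and> P \<kappa> \<and> (\<forall>\<mu>. Cinfinite \<mu> \<and> P \<mu> \<longrightarrow> \<kappa> \<le>o \<mu>)"
    by auto
  from someI_ex[OF this]
  show "Cinfinite (least_infinite_card P)" "P (least_infinite_card P)"
    and "\<And>\<mu>. Cinfinite \<mu> \<Longrightarrow> P \<mu> \<Longrightarrow> least_infinite_card P \<le>o \<mu>"
    unfolding least_infinite_card_def by blast+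
qed

text \<open>Type on which the cardinal invariants of an \<^typ>\<open>'a topology\<close> live: it is infinite and at
  least as large as every family of subsets of the space.\<close>

type_synonym 'a fam = "'a set + nat"

lemma Cinfinite_fam: "Cinfinite |UNIV :: 'a fam set|"
  by (simp add: cinfinite_def Field_card_of finite_Plus_UNIV_iff card_of_card_order_on)

lemma card_of_family_le_fam: "|\<B> :: 'a set set| \<le>o |UNIV :: 'a fam set|"
  by (rule card_of_ordLeqI[of Inl]) auto

text \<open>Supremum of a set of infinite cardinals (\<open>\<aleph>\<^sub>0\<close> for the empty set).\<close>

definition card_Sup :: "'b rel set \<Rightarrow> 'b rel" where
  "card_Sup R = least_infinite_card (\<lambda>\<kappa>. \<forall>r\<in>R. r \<le>o \<kappa>)"

definition urysohn_space :: "'a topology \<Rightarrow> bool" where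
  "urysohn_space X \<longleftrightarrow>
     (\<forall>x\<in>topspace X. \<forall>y\<in>topspace X. x \<noteq> y \<longrightarrow>
        (\<exists>U V. openin X U \<and> x \<in> U \<and> openin X V \<and> y \<in> V \<and>
               (X closure_of U) \<inter> (X closure_of V) = {}))"

definition local_base :: "'a topology \<Rightarrow> 'a \<Rightarrow> 'a set set \<Rightarrow> bool" where
  "local_base X x \<B> \<longleftrightarrow>
     (\<forall>B\<in>\<B>. openin X B \<and> x \<in> B) \<and>
     (\<forall>U. openin X U \<and> x \<in> U \<longrightarrow> (\<exists>B\<in>\<B>. B \<subseteq> U))"

definition character_at :: "'a topology \<Rightarrow> 'a \<Rightarrow> 'a fam rel" where
  "character_at X x = least_infinite_card (\<lambda>\<kappa>. \<exists>\<B>. local_base X x \<B> \<and> |\<B>| \<le>o \<kappa>)"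

definition character :: "'a topology \<Rightarrow> 'a fam rel" where
  "character X = card_Sup (character_at X ` topspace X)"

definition swL :: "'a set \<Rightarrow> 'a topology \<Rightarrow> 'l rel \<Rightarrow> 'a fam rel" where
  "swL A X \<theta> = least_infinite_card (\<lambda>\<kappa>.
     \<forall>\<U>. (\<forall>U\<in>\<U>. openin X U) \<and> A \<subseteq> \<Union>\<U> \<longrightarrow>
       (\<exists>\<V>\<subseteq>\<U>. |\<V>| \<le>o \<kappa> \<and> |A - X closure_of \<Union>\<V>| <o \<theta>))"

definition swLc :: "'a topology \<Rightarrow> 'l rel \<Rightarrow> 'a fam rel" where
  "swLc X \<theta> = card_Sup {swL A X \<theta> | A. closedin X A}"

text \<open>The choices above are never vacuous.\<close>

lemma card_Sup:
  fixes R :: "'a fam rel set"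
  assumes "\<And>r. r \<in> R \<Longrightarrow> Card_order r"
  shows "Cinfinite (card_Sup R)" "\<And>r. r \<in> R \<Longrightarrow> r \<le>o card_Sup R"
    and "\<And>\<mu> :: 'a fam rel. Cinfinite \<mu> \<Longrightarrow> (\<And>r. r \<in> R \<Longrightarrow> r \<le>o \<mu>) \<Longrightarrow> card_Sup R \<le>o \<mu>"
proof -
  have "\<forall>r\<in>R. r \<le>o |UNIV :: 'a fam set|"
    using assms card_of_Field_ordIso ordIso_ordLeq_trans[OF ordIso_symmetric card_of_mono1]
    by blast
  note least = least_infinite_card[where P = "\<lambda>\<kappa>. \<forall>r\<in>R. r \<le>o \<kappa>", OF Cinfinite_fam this]
  show "Cinfinite (card_Sup R)" "\<And>r. r \<in> R \<Longrightarrow> r \<le>o card_Sup R"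
    and "\<And>\<mu> :: 'a fam rel. Cinfinite \<mu> \<Longrightarrow> (\<And>r. r \<in> R \<Longrightarrow> r \<le>o \<mu>) \<Longrightarrow> card_Sup R \<le>o \<mu>"
    unfolding card_Sup_def using least(1,2) by (blast, blast) (rule least(3); blast)
qed

lemma character_at:
  shows "Cinfinite (character_at X x)"
    and "\<exists>\<B>. local_base X x \<B> \<and> |\<B>| \<le>o character_at X x"
proof -
  have "local_base X x {U. openin X U \<and> x \<in> U}"
    unfolding local_base_def by blast
  then have "\<exists>\<B>. local_base X x \<B> \<and> |\<B>| \<le>o |UNIV :: 'a fam set|"
    using card_of_family_le_fam by blast
  note least = least_infinite_card[where P = "\<lambda>\<kappa>. \<exists>\<B>. local_base X x \<B> \<and> |\<B>| \<le>o \<kappa>",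
      OF Cinfinite_fam this]
  show "Cinfinite (character_at X x)"
    and "\<exists>\<B>. local_base X x \<B> \<and> |\<B>| \<le>o character_at X x"
    using least(1,2) unfolding character_at_def by blast+
qed

lemma swL:
  fixes X :: "'a topology"
  assumes "Cinfinite \<theta>" "A \<subseteq> topspace X"
  shows "Cinfinite (swL A X \<theta>)"
    and "(\<And>U. U \<in> \<U> \<Longrightarrow> openin X U) \<Longrightarrow> A \<subseteq> \<Union>\<U> \<Longrightarrow>
           \<exists>\<V>\<subseteq>\<U>. |\<V>| \<le>o swL A X \<theta> \<and> |A - X closure_of \<Union>\<V>| <o \<theta>"
proof -
  have "|A - X closure_of \<Union>\<U>| <o \<theta>"
    if "\<forall>U\<in>\<U>. openin X U" "A \<subseteq> \<Union>\<U>" for \<U>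
  proof -
    have "\<Union>\<U> \<subseteq> X closure_of \<Union>\<U>"
      using that by (intro closure_of_subset) (blast dest: openin_subset)
    then have "A - X closure_of \<Union>\<U> = {}"
      using that by blast
    then have "finite (A - X closure_of \<Union>\<U>)" by (metis finite.emptyI)
    then show ?thesis
      using assms(1) finite_ordLess_infinite[OF card_of_Well_order]
      by (metis Field_card_of card_order_on_well_order_on cinfinite_def)
  qed
  then have "\<forall>\<U>. (\<forall>U\<in>\<U>. openin X U) \<and> A \<subseteq> \<Union>\<U> \<longrightarrow>
       (\<exists>\<V>\<subseteq>\<U>. |\<V>| \<le>o |UNIV :: 'a fam set| \<and> |A - X closure_of \<Union>\<V>| <o \<theta>)"
    using card_of_family_le_fam by blast
  note least = least_infinite_card[where P = "\<lambda>\<kappa>. \<forall>\<U>. (\<forall>U\<in>\<U>. openin X U) \<and> A \<subseteq> \<Union>\<U> \<longrightarrow>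
       (\<exists>\<V>\<subseteq>\<U>. |\<V>| \<le>o \<kappa> \<and> |A - X closure_of \<Union>\<V>| <o \<theta>)", OF Cinfinite_fam this]
  show "Cinfinite (swL A X \<theta>)"
    using least(1) unfolding swL_def .
  show "(\<And>U. U \<in> \<U> \<Longrightarrow> openin X U) \<Longrightarrow> A \<subseteq> \<Union>\<U> \<Longrightarrow>
           \<exists>\<V>\<subseteq>\<U>. |\<V>| \<le>o swL A X \<theta> \<and> |A - X closure_of \<Union>\<V>| <o \<theta>"
    using least(2) unfolding swL_def by blast
qed

end

theory Submission
  imports Defs
begin

text \<open>The \<theta>-closure of \<open>A\<close> consists of the points all of whose neighborhoods \<open>U\<close> have closures
  meeting \<open>A\<close>.  Write \<open>\<mu>\<close> for the character of \<open>X\<close>, \<open>\<theta> = 2\<^sup>\<mu>\<close>,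
  \<open>\<kappa> = swL\<^sub>c(X, \<theta>) \<cdot> \<mu>\<close> and \<open>\<tau> = 2\<^sup>\<kappa>\<close>.  The proof builds a set \<open>H\<close> with at most \<open>\<tau>\<close> points
  and shows that it exhausts the space.

  Two demands are made on \<open>H\<close>.  It must be \<theta>-closed; and for each family \<open>\<V>\<close> of at most \<open>\<kappa>\<close> basic
  neighborhoods of points of \<open>H\<close>, it must contain either the whole of the gap
  \<open>X - cl(\<Union>\<V>)\<close>, when the gap has at most \<open>\<tau>\<close> points, or else \<open>\<tau>\<close> of its points
  (\<open>subset_all_or_large\<close>).  Both are closure conditions under operations applied to subsets of
  size at most \<open>\<kappa>\<close>: a point in the \<theta>-closure of \<open>H\<close> is already in the \<theta>-closure of \<open>\<mu>\<close>
  points of \<open>H\<close> (\<open>theta_closure_generated_by_small\<close>).  Each of these operations produces at most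
  \<open>\<tau>\<close> points.  For the \<theta>-closure this is where the Urysohn property is used
  (\<open>card_of_theta_closure\<close>).  Since \<open>\<tau>\<^sup>\<kappa> = \<tau>\<close>, iterating \<open>\<kappa>\<^sup>+\<close> times yields \<open>H\<close>
  (\<open>small_closed_set_exists\<close>).

  Suppose that \<open>H\<close> misses a point \<open>q\<close>.  As \<open>H\<close> is \<theta>-closed, \<open>q\<close> has an open neighborhood \<open>W\<close>
  whose closure misses \<open>H\<close>, so \<open>H\<close> is covered by basic neighborhoods disjoint from \<open>W\<close>.
  The skew weak Lindeloef degree gives a subfamily \<open>\<V>\<close> of size at most \<open>\<kappa>\<close> whose gap meets \<open>H\<close> in fewer
  than \<open>\<theta> \<le> \<tau>\<close> points.  The second demand then forces the whole gap into \<open>H\<close>; but \<open>q\<close> lies in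
  the gap, because \<open>W\<close> is disjoint from \<open>\<Union>\<V>\<close>
  (\<open>theta_closed_eq_topspace_if_gaps_large\<close>).\<close>

section \<open>Closing off under operations of small arity\<close>

lemma ordLess_if_cexp_ordLeq:
  assumes "Cinfinite \<kappa>" "Cinfinite \<tau>" "\<tau> ^c \<kappa> \<le>o \<tau>"
  shows "\<kappa> <o \<tau>"
proof -
  have "\<kappa> <o ctwo ^c \<kappa>"
    using assms(1) by (intro ordLess_ctwo_cexp) simp
  also have "ctwo ^c \<kappa> \<le>o \<tau> ^c \<kappa>"
    using assms by (intro cexp_mono1 ctwo_ordLeq_Cinfinite) auto
  finally show ?thesis
    using assms(3) ordLess_ordLeq_trans by blast
qed

lemma card_of_Pow_mono:
  assumes "|A| \<le>o |B|"
  shows "|Pow A| \<le>o |Pow B|"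
proof -
  obtain f where "inj_on f A" "f ` A \<subseteq> B"
    using assms card_of_ordLeq by metis
  then have "inj_on (image f) (Pow A)" "image f ` Pow A \<subseteq> Pow B"
    by (auto intro: inj_on_image_Pow)
  then show ?thesis
    using card_of_ordLeq by metis
qed

text \<open>A nonempty set of size at most \<open>\<kappa>\<close> is the range of a function on \<open>\<kappa>\<close>, and
  there are at most \<open>\<tau>\<^sup>\<kappa>\<close> functions from \<open>\<kappa>\<close> to a set of size \<open>\<tau>\<close>.\<close>

lemma card_of_small_subsets:
  assumes "Cinfinite \<kappa>" "Cinfinite \<tau>" "\<tau> ^c \<kappa> \<le>o \<tau>" "|A| \<le>o \<tau>"
  shows "|{C. C \<subseteq> A \<and> |C| \<le>o \<kappa>}| \<le>o \<tau>"
proof -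
  have "{C. C \<subseteq> A \<and> |C| \<le>o \<kappa>} \<subseteq> {{}} \<union> (\<lambda>f. f ` Field \<kappa>) ` Func (Field \<kappa>) A"
  proof
    fix C assume C: "C \<in> {C. C \<subseteq> A \<and> |C| \<le>o \<kappa>}"
    show "C \<in> {{}} \<union> (\<lambda>f. f ` Field \<kappa>) ` Func (Field \<kappa>) A"
    proof (cases "C = {}")
      case False
      have "|C| \<le>o |Field \<kappa>|"
        using C assms(1) card_of_Field_ordIso ordIso_symmetric ordLeq_ordIso_trans by blast
      then obtain g where g: "g ` Field \<kappa> = C"
        using card_of_ordLeq2[OF False] by metis
      define f where "f = (\<lambda>i. if i \<in> Field \<kappa> then g i else undefined)"
      have "f \<in> Func (Field \<kappa>) A" "f ` Field \<kappa> = C"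
        using g C by (auto simp: f_def Func_def)
      then show ?thesis by blast
    qed simp
  qed
  moreover have "|{{}} \<union> (\<lambda>f. f ` Field \<kappa>) ` Func (Field \<kappa>) A| \<le>o \<tau>"
  proof (rule Un_Cinfinite_bound)
    show "|{{}}| \<le>o \<tau>"
      using assms(2) by (intro Card_order_singl_ordLeq) (auto simp: cinfinite_def)
    have "|(\<lambda>f. f ` Field \<kappa>) ` Func (Field \<kappa>) A| \<le>o |A| ^c \<kappa>"
      using card_of_image[of _ "Func (Field \<kappa>) A"] by (simp add: cexp_def Field_card_of)
    also have "|A| ^c \<kappa> \<le>o \<tau> ^c \<kappa>"
      using assms by (intro cexp_mono1) auto
    finally show "|(\<lambda>f. f ` Field \<kappa>) ` Func (Field \<kappa>) A| \<le>o \<tau>"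
      using assms(3) ordLeq_transitive by blast
  qed (fact assms(2))
  ultimately show ?thesis
    by (rule ordLeq_transitive[OF card_of_mono1])
qed

text \<open>Close off along the successor cardinal of \<open>\<kappa>\<close>, adding at each step the values of \<open>F\<close> at all
  small subsets of what has been reached.  A step keeps the size at most \<open>\<tau>\<close>, and so does
  the union of at most \<open>\<kappa>\<^sup>+ \<le> \<tau>\<close> stages.  As \<open>\<kappa>\<^sup>+\<close> is regular, a subset of size \<open>\<kappa>\<close> of the union of all
  stages is contained in one stage, hence its value under \<open>F\<close> in the next.\<close>

lemma small_closed_set_exists:
  fixes F :: "'a set \<Rightarrow> 'a set"
  assumes \<kappa>: "Cinfinite \<kappa>" and \<tau>: "Cinfinite \<tau>" "\<tau> ^c \<kappa> \<le>o \<tau>"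
    and F: "\<And>C. |C| \<le>o \<kappa> \<Longrightarrow> |F C| \<le>o \<tau>"
  obtains H where "|H| \<le>o \<tau>" "\<And>C. C \<subseteq> H \<Longrightarrow> |C| \<le>o \<kappa> \<Longrightarrow> F C \<subseteq> H"
proof -
  (* r indexes the stages, G is one step, and L i is the set reached before step i. *)
  define r where "r = cardSuc \<kappa>"
  have r: "Cinfinite r"
    using Cinfinite_cardSuc[OF \<kappa>] by (simp add: r_def)
  then have wo: "wo_rel r"
    by (simp add: wo_rel_def card_order_on_well_order_on)
  define G where "G = (\<lambda>A. A \<union> (\<Union>C\<in>{C. C \<subseteq> A \<and> |C| \<le>o \<kappa>}. F C))"
  define L where "L = wo_rel.worec r (\<lambda>f i. \<Union>j\<in>underS r i. G (f j))"
  have L: "L i = (\<Union>j\<in>underS r i. G (L j))" for i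
  proof -
    have "wo_rel.adm_wo r (\<lambda>f i. \<Union>j\<in>underS r i. G (f j))"
      unfolding wo_rel.adm_wo_def[OF wo] by simp
    from fun_cong[OF wo_rel.worec_fixpoint[OF wo this], of i] show ?thesis
      unfolding L_def .
  qed
  have mono: "relChain r L"
    unfolding relChain_def
  proof (intro allI impI)
    fix i j assume "(i, j) \<in> r"
    then have "underS r i \<subseteq> underS r j"
      by (rule underS_incr[OF wo_rel.TRANS[OF wo] wo_rel.ANTISYM[OF wo]])
    then show "L i \<subseteq> L j"
      using L[of i] L[of j] by blast
  qed
  have r_le: "r \<le>o \<tau>"
    unfolding r_def using \<kappa> \<tau> ordLess_if_cexp_ordLeq[OF \<kappa> \<tau>]
    by (intro cardSuc_least) auto
  have G: "|G A| \<le>o \<tau>" if "|A| \<le>o \<tau>" for A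
    unfolding G_def using that card_of_small_subsets[OF \<kappa> \<tau> that] F \<tau>
    by (intro Un_Cinfinite_bound UNION_Cinfinite_bound) auto
  have bound: "i \<in> Field r \<longrightarrow> |L i| \<le>o \<tau>" for i
  proof (induction i rule: wo_rel.well_order_induct[OF wo])
    case (1 i)
    show ?case
    proof
      assume i: "i \<in> Field r"
      have "|underS r i| \<le>o \<tau>"
        using card_of_underS[OF _ i] r r_le ordLess_imp_ordLeq ordLeq_transitive by blast
      moreover have "|G (L j)| \<le>o \<tau>" if "j \<in> underS r i" for j
        using that 1 by (intro G) (auto simp: underS_def Field_def)
      ultimately show "|L i| \<le>o \<tau>"
        unfolding L[of i] using \<tau> by (intro UNION_Cinfinite_bound) auto
    qed
  qed
  show ?thesis
  proof
    have "|Field r| \<le>o \<tau>"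
      using r r_le card_of_Field_ordIso ordIso_ordLeq_trans by blast
    then show "|\<Union>i\<in>Field r. L i| \<le>o \<tau>"
      using bound \<tau> by (intro UNION_Cinfinite_bound) auto
    fix C assume C: "C \<subseteq> (\<Union>i\<in>Field r. L i)" "|C| \<le>o \<kappa>"
    obtain i where i: "i \<in> Field r" "C \<subseteq> L i"
      using cardSuc_UNION_Cinfinite[OF \<kappa> mono[unfolded r_def], of C] C unfolding r_def by blast
    obtain j where j: "j \<in> Field r" "i \<noteq> j" "(i, j) \<in> r"
      using Cinfinite_limit[OF i(1) r] by blast
    have "F C \<subseteq> G (L i)"
      using i C unfolding G_def by blast
    also have "\<dots> \<subseteq> L j"
      using j unfolding L[of j] underS_def by blast
    finally show "F C \<subseteq> (\<Union>i\<in>Field r. L i)"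
      using j by blast
  qed
qed

lemma subset_all_or_large:
  assumes "Card_order \<tau>"
  obtains S where "S \<subseteq> Y" "|S| \<le>o \<tau>" "S = Y \<or> \<tau> \<le>o |S|"
proof (cases "|Y| \<le>o \<tau>")
  case False
  have "|Field \<tau>| =o \<tau>"
    using assms card_of_Field_ordIso by blast
  moreover from False have "\<tau> \<le>o |Y|"
    using assms ordLeq_total card_of_Well_order card_order_on_well_order_on by metis
  ultimately have "|Field \<tau>| \<le>o |Y|"
    using ordIso_ordLeq_trans by blast
  then obtain f where f: "inj_on f (Field \<tau>)" "f ` Field \<tau> \<subseteq> Y"
    using card_of_ordLeq by metis
  then have "|f ` Field \<tau>| =o |Field \<tau>|"
    using card_of_ordIso[of "Field \<tau>" "f ` Field \<tau>"] ordIso_symmetric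
    by (metis bij_betw_def)
  then have "|f ` Field \<tau>| =o \<tau>"
    using \<open>|Field \<tau>| =o \<tau>\<close> ordIso_transitive by blast
  then show ?thesis
    using that[of "f ` Field \<tau>"] f ordIso_iff_ordLeq by blast
qed (use that in auto)

section \<open>The theta-closure\<close>

definition theta_closure :: "'a topology \<Rightarrow> 'a set \<Rightarrow> 'a set" where
  "theta_closure X A =
     {x \<in> topspace X. \<forall>U. openin X U \<and> x \<in> U \<longrightarrow> A \<inter> X closure_of U \<noteq> {}}"

lemma closure_of_subset_theta_closure: "X closure_of A \<subseteq> theta_closure X A"
proof
  fix x assume x: "x \<in> X closure_of A"
  have "A \<inter> X closure_of U \<noteq> {}" if U: "openin X U" "x \<in> U" for U
  proof -
    obtain y where "y \<in> A" "y \<in> U"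
      using x U unfolding in_closure_of by metis
    then show ?thesis
      using closure_of_subset[OF openin_subset[OF U(1)]] by blast
  qed
  then show "x \<in> theta_closure X A"
    using x unfolding theta_closure_def by (simp add: in_closure_of)
qed

lemma local_base_image_openin:
  assumes "local_base X x (b ` I)" "i \<in> I"
  shows "openin X (b i)" "x \<in> b i"
  using assms unfolding local_base_def by auto

lemma local_base_image_subset:
  assumes "local_base X x (b ` I)" "openin X U" "x \<in> U"
  obtains i where "i \<in> I" "b i \<subseteq> U"
  using assms unfolding local_base_def by auto

text \<open>Local bases are indexed by \<open>Field \<mu>\<close>, with repetitions, so that the bases of different
  points share one index set.\<close>

lemma local_base_indexed:
  assumes "Card_order \<mu>" "local_base X x \<B>" "|\<B>| \<le>o \<mu>" "x \<in> topspace X"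
  obtains b where "local_base X x (b ` Field \<mu>)"
proof -
  have "\<B> \<noteq> {}"
    using assms(2,4) unfolding local_base_def by blast
  moreover have "|\<B>| \<le>o |Field \<mu>|"
    using assms(1,3) card_of_Field_ordIso ordIso_symmetric ordLeq_ordIso_trans by blast
  ultimately obtain b where "b ` Field \<mu> = \<B>"
    using card_of_ordLeq2 by metis
  then show ?thesis
    using assms(2) that by blast
qed

lemma character_indexed_bases:
  fixes X :: "'a topology"
  obtains b where "\<And>x. x \<in> topspace X \<Longrightarrow> local_base X x (b x ` Field (character X))"
proof -
  have ch: "Cinfinite (character X)"
    unfolding character_def by (intro card_Sup(1)) (auto simp: character_at(1))
  have "\<exists>b. local_base X x (b ` Field (character X))" if x: "x \<in> topspace X" for x
  proof -
    obtain \<B> where \<B>: "local_base X x \<B>" "|\<B>| \<le>o character_at X x"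
      using character_at(2)[of X x] by metis
    have "character_at X x \<le>o character X"
      unfolding character_def using x by (intro card_Sup(2)) (auto simp: character_at(1))
    with \<B>(2) have "|\<B>| \<le>o character X"
      using ordLeq_transitive by blast
    with ch \<B>(1) x show ?thesis
      using local_base_indexed[OF _ \<B>(1) _ x] by metis
  qed
  then have "\<forall>x. \<exists>b. x \<in> topspace X \<longrightarrow> local_base X x (b ` Field (character X))"
    by blast
  then obtain b where "\<forall>x. x \<in> topspace X \<longrightarrow> local_base X x (b x ` Field (character X))"
    by metis
  then show ?thesis
    using that by blast
qed

text \<open>To each \<open>x\<close> in the \<theta>-closure of \<open>A\<close> assign a matrix \<open>c x\<close> of points of \<open>A\<close>, the entry at
  \<open>(i, j)\<close> lying in the closure of the intersection of the \<open>i\<close>-th and the \<open>j\<close>-th basic neighborhoods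
  of \<open>x\<close>.  The double index makes \<open>x\<close> recoverable from its matrix: if \<open>x \<noteq> y\<close>, the Urysohn
  property yields an index \<open>i\<close> for \<open>x\<close> and an index \<open>j\<close> for \<open>y\<close> whose basic neighborhoods have
  disjoint closures, and then the entries \<open>c x i j\<close> and \<open>c y i j\<close> lie in these two closures.\<close>

lemma card_of_theta_closure:
  fixes X :: "'a topology"
  assumes ury: "urysohn_space X" and \<mu>: "Cinfinite \<mu>"
    and b: "\<And>x. x \<in> topspace X \<Longrightarrow> local_base X x (b x ` Field \<mu>)"
  shows "|theta_closure X A| \<le>o |A| ^c \<mu>"
proof -
  let ?I = "Field \<mu>"
  have "\<exists>c. \<forall>i\<in>?I. \<forall>j\<in>?I. c i j \<in> A \<inter> X closure_of (b x i \<inter> b x j)"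
    if "x \<in> theta_closure X A" for x
  proof -
    from that have x: "x \<in> topspace X"
      unfolding theta_closure_def by blast
    have "\<exists>a. a \<in> A \<inter> X closure_of (b x i \<inter> b x j)" if "i \<in> ?I" "j \<in> ?I" for i j
    proof -
      have "openin X (b x i \<inter> b x j)" "x \<in> b x i \<inter> b x j"
        using local_base_image_openin[OF b[OF x]] that by (auto intro: openin_Int)
      then show ?thesis
        using \<open>x \<in> theta_closure X A\<close> unfolding theta_closure_def by blast
    qed
    then show ?thesis by metis
  qed
  then obtain c where c: "\<And>x i j. x \<in> theta_closure X A \<Longrightarrow> i \<in> ?I \<Longrightarrow> j \<in> ?I \<Longrightarrow>
      c x i j \<in> A \<inter> X closure_of (b x i \<inter> b x j)"
    by metis
  define f where "f = (\<lambda>x p. if p \<in> ?I \<times> ?I then c x (fst p) (snd p) else undefined)"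
  have "f ` theta_closure X A \<subseteq> Func (?I \<times> ?I) A"
    using c by (force simp: f_def Func_def)
  moreover have "inj_on f (theta_closure X A)"
  proof (rule inj_onI, rule ccontr)
    fix x y assume xy: "x \<in> theta_closure X A" "y \<in> theta_closure X A" "f x = f y" "x \<noteq> y"
    then have tx: "x \<in> topspace X" "y \<in> topspace X"
      unfolding theta_closure_def by auto
    then obtain U V where UV: "openin X U" "x \<in> U" "openin X V" "y \<in> V"
        "(X closure_of U) \<inter> (X closure_of V) = {}"
      using ury[unfolded urysohn_space_def, rule_format, OF tx xy(4)] by metis
    obtain i where i: "i \<in> ?I" "b x i \<subseteq> U"
      using local_base_image_subset[OF b[OF tx(1)] UV(1,2)] by metis
    obtain j where j: "j \<in> ?I" "b y j \<subseteq> V"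
      using local_base_image_subset[OF b[OF tx(2)] UV(3,4)] by metis
    have "c x i j = c y i j"
      using fun_cong[OF xy(3), of "(i, j)"] i j by (simp add: f_def)
    moreover have "c x i j \<in> X closure_of U"
      using c[OF xy(1) i(1) j(1)] closure_of_mono[of "b x i \<inter> b x j" U X] i by blast
    moreover have "c y i j \<in> X closure_of V"
      using c[OF xy(2) i(1) j(1)] closure_of_mono[of "b y i \<inter> b y j" V X] j by blast
    ultimately show False
      using UV(5) by auto
  qed
  ultimately have "|theta_closure X A| \<le>o |Func (?I \<times> ?I) A|"
    using card_of_ordLeq by blast
  also have "|Func (?I \<times> ?I) A| = |A| ^c (\<mu> *c \<mu>)"
    by (simp add: cexp_def cprod_def Field_card_of)
  also have "|A| ^c (\<mu> *c \<mu>) =o |A| ^c \<mu>"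
    using \<mu> by (intro cexp_cong2 cprod_infinite card_of_Card_order Card_order_cprod) auto
  finally show ?thesis .
qed

lemma theta_closure_generated_by_small:
  assumes \<mu>: "Card_order \<mu>"
    and b: "\<And>x. x \<in> topspace X \<Longrightarrow> local_base X x (b x ` Field \<mu>)"
    and x: "x \<in> theta_closure X A"
  obtains C where "C \<subseteq> A" "|C| \<le>o \<mu>" "x \<in> theta_closure X C"
proof -
  have tx: "x \<in> topspace X"
    using x unfolding theta_closure_def by blast
  have "\<forall>i\<in>Field \<mu>. \<exists>a. a \<in> A \<inter> X closure_of (b x i)"
    using x local_base_image_openin[OF b[OF tx]] unfolding theta_closure_def by blast
  then obtain c where c: "\<And>i. i \<in> Field \<mu> \<Longrightarrow> c i \<in> A \<inter> X closure_of (b x i)"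
    by metis
  show ?thesis
  proof
    show "c ` Field \<mu> \<subseteq> A"
      using c by blast
    show "|c ` Field \<mu>| \<le>o \<mu>"
      using card_of_image card_of_Field_ordIso[OF \<mu>] ordLeq_ordIso_trans by blast
    have "c ` Field \<mu> \<inter> X closure_of U \<noteq> {}" if "openin X U" "x \<in> U" for U
    proof -
      obtain i where i: "i \<in> Field \<mu>" "b x i \<subseteq> U"
        using local_base_image_subset[OF b[OF tx] \<open>openin X U\<close> \<open>x \<in> U\<close>] by metis
      have "c i \<in> A" "c i \<in> X closure_of U"
        using c[OF i(1)] closure_of_mono[OF i(2), of X] by auto
      then show ?thesis
        using i(1) by auto
    qed
    then show "x \<in> theta_closure X (c ` Field \<mu>)"
      using tx unfolding theta_closure_def by blast
  qed
qed

section \<open>The cardinality bound\<close>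

text \<open>A point outside \<open>H\<close> would lie in the gap of a family of basic neighborhoods that covers all but
  fewer than \<open>\<theta>\<close> points of \<open>H\<close> up to closure.  So it suffices that each gap of a small family either
  is contained in \<open>H\<close> or meets \<open>H\<close> in at least \<open>\<theta>\<close> points.\<close>

lemma theta_closed_eq_topspace_if_gaps_large:
  fixes X :: "'a topology"
  assumes \<theta>: "Cinfinite \<theta>" and "H \<subseteq> topspace X" and H: "theta_closure X H \<subseteq> H"
    and b: "\<And>x. x \<in> H \<Longrightarrow> local_base X x (\<B> x)"
    and large: "\<And>\<V>. \<V> \<subseteq> (\<Union>x\<in>H. \<B> x) \<Longrightarrow> |\<V>| \<le>o swLc X \<theta> \<Longrightarrow>
      \<theta> \<le>o |H - X closure_of \<Union>\<V>| \<or> topspace X - X closure_of \<Union>\<V> \<subseteq> H"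
  shows "H = topspace X"
proof (rule ccontr)
  assume "H \<noteq> topspace X"
  then obtain q where q: "q \<in> topspace X" "q \<notin> H"
    using assms(2) by blast
  then obtain W where W: "openin X W" "q \<in> W" "H \<inter> X closure_of W = {}"
    using H unfolding theta_closure_def by blast
  have "X closure_of H \<subseteq> H"
    using closure_of_subset_theta_closure H by (rule order.trans)
  then have closed: "closedin X H"
    using assms(2) closure_of_subset_eq[of H X] by simp
  define \<U> where "\<U> = {B \<in> (\<Union>x\<in>H. \<B> x). B \<inter> W = {}}"
  have op: "openin X U" if "U \<in> \<U>" for U
    using that b unfolding \<U>_def local_base_def by auto
  have "H \<subseteq> \<Union>\<U>"
  proof
    fix x assume x: "x \<in> H"
    have "openin X (topspace X - X closure_of W)"
      by (simp add: openin_diff)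
    moreover have "x \<in> topspace X - X closure_of W"
      using x assms(2) W by blast
    ultimately obtain B where B: "B \<in> \<B> x" "B \<subseteq> topspace X - X closure_of W"
      using b[OF x] unfolding local_base_def by metis
    then have "B \<inter> W = {}"
      using closure_of_subset[OF openin_subset[OF W(1)]] by blast
    moreover have "x \<in> B"
      using B b[OF x] unfolding local_base_def by blast
    ultimately show "x \<in> \<Union>\<U>"
      using B x unfolding \<U>_def by blast
  qed
  with op obtain \<V> where \<V>: "\<V> \<subseteq> \<U>" "|\<V>| \<le>o swL H X \<theta>"
      "|H - X closure_of \<Union>\<V>| <o \<theta>"
    using swL(2)[OF \<theta> assms(2), of \<U>] by blast
  have "swL H X \<theta> \<le>o swLc X \<theta>"
    unfolding swLc_def using closed
    by (intro card_Sup(2)) (auto dest: closedin_subset swL(1)[OF \<theta>])+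
  with \<V>(2) have "|\<V>| \<le>o swLc X \<theta>"
    using ordLeq_transitive by blast
  moreover have "\<V> \<subseteq> (\<Union>x\<in>H. \<B> x)"
    using \<V>(1) unfolding \<U>_def by blast
  ultimately have "topspace X - X closure_of \<Union>\<V> \<subseteq> H"
    using large \<V>(3) not_ordLess_ordLeq by blast
  moreover have "W \<inter> \<Union>\<V> = {}"
    using \<V>(1) unfolding \<U>_def by blast
  then have "q \<notin> X closure_of \<Union>\<V>"
    using W unfolding in_closure_of by blast
  ultimately show False
    using q by blast
qed

theorem theorem5p3:
  fixes X :: "'a topology"
  assumes "urysohn_space X"
  shows "|topspace X| \<le>o ctwo ^c (swLc X (ctwo ^c character X) *c character X)"
proof -
  define \<mu> where "\<mu> = character X"
  define \<theta> where "\<theta> = ctwo ^c \<mu>"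
  define \<kappa> where "\<kappa> = swLc X \<theta> *c \<mu>"
  define \<tau> where "\<tau> = ctwo ^c \<kappa>"
  have \<mu>: "Cinfinite \<mu>"
    unfolding \<mu>_def character_def by (intro card_Sup(1)) (auto simp: character_at(1))
  have c2: "Card_order ctwo" "ctwo \<le>o ctwo"
    by (auto simp: Card_order_ctwo ordLeq_refl)
  have \<theta>: "Cinfinite \<theta>"
    unfolding \<theta>_def by (intro Cinfinite_cexp c2 \<mu>)
  have sw: "Cinfinite (swLc X \<theta>)"
    unfolding swLc_def by (intro card_Sup(1)) (auto dest: closedin_subset swL(1)[OF \<theta>])
  have \<kappa>: "Cinfinite \<kappa>"
    unfolding \<kappa>_def using sw \<mu> by (intro Cinfinite_cprod2 Cinfinite_Cnotzero)
  have \<mu>\<kappa>: "\<mu> \<le>o \<kappa>"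
    unfolding \<kappa>_def using sw \<mu> by (intro ordLeq_cprod2 Cinfinite_Cnotzero) auto
  have sw\<kappa>: "swLc X \<theta> \<le>o \<kappa>"
    unfolding \<kappa>_def cprod_def using sw \<mu> by (intro Card_order_Times1) (auto simp: cinfinite_def)
  have \<tau>: "Cinfinite \<tau>"
    unfolding \<tau>_def by (intro Cinfinite_cexp c2 \<kappa>)
  have \<tau>\<kappa>: "\<tau> ^c \<kappa> \<le>o \<tau>"
    unfolding \<tau>_def using c2 \<kappa> Cinfinite_Cnotzero[OF \<kappa>]
    by (intro ordIso_imp_ordLeq cexp_cprod_ordLeq ordLeq_refl) auto
  have \<theta>\<tau>: "\<theta> \<le>o \<tau>"
    unfolding \<theta>_def \<tau>_def using \<mu>\<kappa> c2 Cinfinite_Cnotzero[OF \<mu>]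
    by (intro cexp_mono2_Cnotzero) auto
  have \<kappa>\<tau>: "\<kappa> \<le>o \<tau>"
    using ordLess_if_cexp_ordLeq[OF \<kappa> \<tau> \<tau>\<kappa>] ordLess_imp_ordLeq by blast
  obtain b where b: "\<And>x. x \<in> topspace X \<Longrightarrow> local_base X x (b x ` Field \<mu>)"
    using character_indexed_bases[of X] unfolding \<mu>_def by blast
  have "\<forall>\<V>. \<exists>S. S \<subseteq> topspace X - X closure_of \<Union>\<V> \<and> |S| \<le>o \<tau> \<and>
      (S = topspace X - X closure_of \<Union>\<V> \<or> \<tau> \<le>o |S| )"
    using subset_all_or_large \<tau> by metis
  then obtain S where S: "\<And>\<V>. S \<V> \<subseteq> topspace X - X closure_of \<Union>\<V>" "\<And>\<V>. |S \<V>| \<le>o \<tau>"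
      "\<And>\<V>. S \<V> = topspace X - X closure_of \<Union>\<V> \<or> \<tau> \<le>o |S \<V>|"
    by metis
  (* F combines both demands on H; S selects the points of a gap that H has to contain. *)
  define F where "F = (\<lambda>C. theta_closure X C \<union> (\<Union>\<V>\<in>Pow (\<Union>x\<in>C. b x ` Field \<mu>). S \<V>))"
  have "|F C| \<le>o \<tau>" if C: "|C| \<le>o \<kappa>" for C
  proof -
    have "|C| \<le>o \<tau>"
      using C \<kappa>\<tau> ordLeq_transitive by blast
    then have le: "|C| ^c \<mu> \<le>o \<tau> ^c \<kappa>"
      using \<mu>\<kappa> \<mu> \<tau> Cinfinite_Cnotzero[OF \<mu>] czeroI
      by (intro cexp_mono') (auto simp: cinfinite_def)
    have th: "|theta_closure X C| \<le>o \<tau>"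
      by (rule ordLeq_transitive[OF card_of_theta_closure[OF assms \<mu> b]
            ordLeq_transitive[OF le \<tau>\<kappa>]]) auto
    have "|b x ` Field \<mu>| \<le>o \<kappa>" for x
      using card_of_image[of "b x" "Field \<mu>"] card_of_Field_ordIso[of \<mu>] \<mu> \<mu>\<kappa>
        ordLeq_ordIso_trans ordLeq_transitive by blast
    then have "|\<Union>x\<in>C. b x ` Field \<mu>| \<le>o \<kappa>"
      using C \<kappa> by (intro UNION_Cinfinite_bound) auto
    then have "|\<Union>x\<in>C. b x ` Field \<mu>| \<le>o |Field \<kappa>|"
      using \<kappa> card_of_Field_ordIso ordIso_symmetric ordLeq_ordIso_trans by blast
    then have "|Pow (\<Union>x\<in>C. b x ` Field \<mu>)| \<le>o |Pow (Field \<kappa>)|"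
      by (rule card_of_Pow_mono)
    also have "|Pow (Field \<kappa>)| =o \<tau>"
      unfolding \<tau>_def ctwo_def cexp_def Field_card_of by (rule card_of_Pow_Func)
    finally have "|\<Union>\<V>\<in>Pow (\<Union>x\<in>C. b x ` Field \<mu>). S \<V>| \<le>o \<tau>"
      using S(2) \<tau> by (intro UNION_Cinfinite_bound) auto
    with th \<tau> show ?thesis
      unfolding F_def by (intro Un_Cinfinite_bound)
  qed
  then obtain H0 where H0: "|H0| \<le>o \<tau>" "\<And>C. C \<subseteq> H0 \<Longrightarrow> |C| \<le>o \<kappa> \<Longrightarrow> F C \<subseteq> H0"
    using small_closed_set_exists[OF \<kappa> \<tau> \<tau>\<kappa>] by metis
  (* H0 may contain elements outside the space, but the values of F lie inside it. *)
  define H where "H = H0 \<inter> topspace X"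
  have "F C \<subseteq> topspace X" for C
    using S(1) unfolding F_def theta_closure_def by blast
  then have HF: "F C \<subseteq> H" if "C \<subseteq> H" "|C| \<le>o \<kappa>" for C
    using H0(2)[of C] that unfolding H_def by blast
  have "H = topspace X"
  proof (rule theta_closed_eq_topspace_if_gaps_large[OF \<theta>])
    show "H \<subseteq> topspace X"
      unfolding H_def by blast
    then show "local_base X x (b x ` Field \<mu>)" if "x \<in> H" for x
      using that b by blast
    show "theta_closure X H \<subseteq> H"
    proof
      fix x assume "x \<in> theta_closure X H"
      then obtain C where C: "C \<subseteq> H" "|C| \<le>o \<mu>" "x \<in> theta_closure X C"
        using theta_closure_generated_by_small[of \<mu> X b x H] \<mu> b by blast
      then have "F C \<subseteq> H"
        using \<mu>\<kappa> ordLeq_transitive by (intro HF) blast+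
      then show "x \<in> H"
        using C(3) unfolding F_def by blast
    qed
  next
    fix \<V> assume \<V>: "\<V> \<subseteq> (\<Union>x\<in>H. b x ` Field \<mu>)" "|\<V>| \<le>o swLc X \<theta>"
    then have "\<forall>V\<in>\<V>. \<exists>x. x \<in> H \<and> V \<in> b x ` Field \<mu>"
      by (auto dest!: subsetD)
    from bchoice[OF this]
    obtain p where p: "\<And>V. V \<in> \<V> \<Longrightarrow> p V \<in> H \<and> V \<in> b (p V) ` Field \<mu>"
      by auto
    have "|p ` \<V>| \<le>o \<kappa>"
      by (rule ordLeq_transitive[OF card_of_image ordLeq_transitive[OF \<V>(2) sw\<kappa>]])
    then have "F (p ` \<V>) \<subseteq> H"
      using p by (intro HF) auto
    moreover have "\<V> \<subseteq> (\<Union>x\<in>p ` \<V>. b x ` Field \<mu>)"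
      using p by auto
    then have "S \<V> \<subseteq> F (p ` \<V>)"
      unfolding F_def by blast
    ultimately have SH: "S \<V> \<subseteq> H"
      by blast
    show "\<theta> \<le>o |H - X closure_of \<Union>\<V>| \<or> topspace X - X closure_of \<Union>\<V> \<subseteq> H"
    proof (cases "S \<V> = topspace X - X closure_of \<Union>\<V>")
      case True
      then show ?thesis
        using SH by blast
    next
      case False
      then have "\<tau> \<le>o |S \<V>|"
        using S(3) by metis
      then have "\<theta> \<le>o |S \<V>|"
        by (rule ordLeq_transitive[OF \<theta>\<tau>])
      moreover have "S \<V> \<subseteq> H - X closure_of \<Union>\<V>"
        using SH S(1)[of \<V>] by blast
      ultimately show ?thesis
        using card_of_mono1 ordLeq_transitive by blast
    qed
  qed
  moreover have "|H| \<le>o \<tau>"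
    by (rule ordLeq_transitive[OF card_of_mono1 H0(1)]) (simp add: H_def)
  ultimately show ?thesis
    unfolding \<tau>_def \<kappa>_def \<theta>_def \<mu>_def by simp
qed

end
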